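(* Suppose the coarse space $\operatorname{Range}(P)$ satisfies the weak approximation property with constant $\eta_w>0$, i.e., for every $\mathbf v\in\mathbb R^n$ there is $\mathbf v_c\in\mathbb R^{n_c}$ such that $\|\mathbf v-P\mathbf v_c\|_D\le\eta_w\|\mathbf v\|_A$. Then the (spectral) condition number $\kappa(A_f)$ of $A_f=P_\perp^TAP_\perp$ satisfies $\kappa(A_f)\le\eta_w^2$.
   Context: $A\in\mathbb R^{n\times n}$ is symmetric positive definite (SPD), and $D\in\mathbb R^{n\times n}$ is a diagonal SPD matrix with $\mathbf v^TA\mathbf v\le\mathbf v^TD\mathbf v$ for all $\mathbf v\in\mathbb R^n$. For an SPD matrix $B$, $\|\mathbf v\|_B=\sqrt{\mathbf v^TB\mathbf v}$. The index set $\{1,\dots,n\}$ is partitioned into nonoverlapping aggregates $\mathcal A_1,\dots,\mathcal A_{n_a}$. The prolongation $P\in\mathbb R^{n\times n_c}$, of full column rank with $1\le n_c<n$, is block diagonal with respect to this partition, with blocks $P_{\mathcal A_i}$ (rows indexed by $\mathcal A_i$). On each aggregate, let $D_{\mathcal A_i}=D|_{\mathcal A_i}$ and choose vectors that are orthonormal with respect to $D_{\mathcal A_i}$ and span the $D_{\mathcal A_i}$-orthogonal complement of $\operatorname{Range}(P_{\mathcal A_i})$. Extended by zero outside $\mathcal A_i$, these vectors (for all $i$) are the columns of $P_\perp\in\mathbb R^{n\times(n-n_c)}$. Thus $P_\perp^TDP=0$ and $P_\perp^TDP_\perp=I$. *)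

theory Defs
  imports
    "HOL-Library.Disjoint_Sets"
    "Jordan_Normal_Form.Spectral_Radius"
    "Jordan_Normal_Form.DL_Rank"
    "Jordan_Normal_Form.DL_Submatrix"
begin

text \<open>
  Indices are 0-based: the index set \<open>{1,...,n}\<close> of the mathematical text is \<open>{..<n}\<close>.
\<close>

definition spd_mat :: "nat \<Rightarrow> real mat \<Rightarrow> bool" where
  "spd_mat n B \<longleftrightarrow> B \<in> carrier_mat n n \<and> B\<^sup>T = B \<and>
     (\<forall>v \<in> carrier_vec n. v \<noteq> 0\<^sub>v n \<longrightarrow> v \<bullet> (B *\<^sub>v v) > 0)"

definition energy_norm :: "real mat \<Rightarrow> real vec \<Rightarrow> real" where
  "energy_norm B v = sqrt (v \<bullet> (B *\<^sub>v v))"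

text \<open>
  Condition number of an SPD matrix: ratio of its extreme eigenvalues. The spectrum is that of a
  \<^emph>\<open>real\<close> matrix, i.e. the set of its real eigenvalues; for symmetric matrices these are all of
  them. For matrices with no real eigenvalue, or with smallest real eigenvalue 0, the value is
  meaningless.
\<close>
definition spectral_condition_number :: "real mat \<Rightarrow> real" where
  "spectral_condition_number B = Max (spectrum B) / Min (spectrum B)"

definition mat_range :: "real mat \<Rightarrow> real vec set" where
  "mat_range M = vec_space.col_space (dim_row M) M"

definition weak_approximation_property ::
  "real mat \<Rightarrow> real mat \<Rightarrow> real mat \<Rightarrow> real \<Rightarrow> bool" where
  "weak_approximation_property A D P \<eta> \<longleftrightarrow>
     (\<forall>v \<in> carrier_vec (dim_row P). \<exists>vc \<in> carrier_vec (dim_col P).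
        energy_norm D (v - P *\<^sub>v vc) \<le> \<eta> * energy_norm A v)"

text \<open>Parts may be empty here: an aggregate may contribute no column to a given block matrix.\<close>
definition indexed_partition :: "nat set \<Rightarrow> nat \<Rightarrow> (nat \<Rightarrow> nat set) \<Rightarrow> bool" where
  "indexed_partition S k X \<longleftrightarrow> disjoint_family_on X {..<k} \<and> (\<Union>i<k. X i) = S"

text \<open>
  Row block \<open>i\<close> has index set \<open>R i\<close> and column block \<open>i\<close> has index set \<open>C i\<close>; the blocks are
  rectangular and need not consist of consecutive indices. The \<open>i\<close>-th diagonal block is
  \<open>submatrix M (R i) (C i)\<close>.
\<close>
definition block_diagonal ::
  "nat \<Rightarrow> (nat \<Rightarrow> nat set) \<Rightarrow> (nat \<Rightarrow> nat set) \<Rightarrow> real mat \<Rightarrow> bool" where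
  "block_diagonal k R C M \<longleftrightarrow>
     indexed_partition {..<dim_row M} k R \<and> indexed_partition {..<dim_col M} k C \<and>
     (\<forall>i<k. \<forall>j<k. i \<noteq> j \<longrightarrow> (\<forall>r \<in> R i. \<forall>c \<in> C j. M $$ (r, c) = 0))"

definition orthonormal_cols_wrt :: "real mat \<Rightarrow> real mat \<Rightarrow> bool" where
  "orthonormal_cols_wrt B Q \<longleftrightarrow>
     (\<forall>i < dim_col Q. \<forall>j < dim_col Q. col Q i \<bullet> (B *\<^sub>v col Q j) = (if i = j then 1 else 0))"

definition orthogonal_complement_wrt :: "real mat \<Rightarrow> real vec set \<Rightarrow> real vec set" where
  "orthogonal_complement_wrt B W =
     {v \<in> carrier_vec (dim_row B). \<forall>w \<in> W. v \<bullet> (B *\<^sub>v w) = 0}"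

text \<open>
  \<open>Q\<close> is a matrix \<open>P\<^sub>\<bottom>\<close>: the columns with index in \<open>F i\<close> vanish outside the aggregate \<open>Agg i\<close>
  (this is \<open>block_diagonal\<close>) and their restrictions to the aggregate are orthonormal with respect
  to the local block of \<open>D\<close> and span the orthogonal complement of the range of the local block
  of \<open>P\<close>.
\<close>
definition aggregate_complement ::
  "nat \<Rightarrow> (nat \<Rightarrow> nat set) \<Rightarrow> (nat \<Rightarrow> nat set) \<Rightarrow> (nat \<Rightarrow> nat set) \<Rightarrow>
   real mat \<Rightarrow> real mat \<Rightarrow> real mat \<Rightarrow> bool" where
  "aggregate_complement k Agg C F D P Q \<longleftrightarrow>
     block_diagonal k Agg F Q \<and>
     (\<forall>i<k. orthonormal_cols_wrt (submatrix D (Agg i) (Agg i)) (submatrix Q (Agg i) (F i)) \<and>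
            mat_range (submatrix Q (Agg i) (F i)) =
              orthogonal_complement_wrt (submatrix D (Agg i) (Agg i))
                (mat_range (submatrix P (Agg i) (C i))))"

end

theory Submission
  imports Defs
begin

text \<open>
  Write \<open>Q\<close> for the matrix \<open>P\<^sub>f\<close> of complementary basis vectors and \<open>\<eta>\<close> for \<open>\<eta>\<^sub>w\<close>. Every
  eigenvalue of \<open>Q\<^sup>T A Q\<close> lies between \<open>1 / \<eta>\<^sup>2\<close> and \<open>1\<close>, so the ratio of any two is at most \<open>\<eta>\<^sup>2\<close>.
  If \<open>x\<close> is an eigenvector for \<open>\<mu>\<close> and \<open>v = Q x\<close>, then \<open>\<mu> (x \<bullet> x)\<close> is the squared \<open>A\<close>-norm of
  \<open>v\<close>, while \<open>x \<bullet> x\<close> is its squared \<open>D\<close>-norm because \<open>Q\<^sup>T D Q\<close> is the identity. Since \<open>A\<close> is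
  dominated by \<open>D\<close>, this gives \<open>\<mu> \<le> 1\<close>. Since \<open>Q\<^sup>T D P = 0\<close>, \<open>v\<close> is \<open>D\<close>-orthogonal to the coarse
  space, so by Pythagoras no coarse vector comes closer to \<open>v\<close> in the \<open>D\<close>-norm than zero does
  (\<open>orthogonal_correction_form_ge\<close>). The weak approximation property then bounds the \<open>D\<close>-norm of
  \<open>v\<close> by \<open>\<eta>\<close> times its \<open>A\<close>-norm, which is \<open>1 \<le> \<eta>\<^sup>2 \<mu>\<close>.

  Two points need separate work. The two matrix identities for \<open>Q\<close> are given only on each aggregate
  separately, for the local blocks; they become global since \<open>D\<close> is diagonal and the columns are supported on single
  aggregates (\<open>block_diagonal_weighted_product\<close>). And the extreme eigenvalues have a meaning only if
  a real eigenvalue exists, which holds by symmetry (\<open>symmetric_real_spectrum_non_empty\<close>).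
\<close>

section \<open>Real eigenvalues of symmetric matrices\<close>

text \<open>
  The spectrum of a real matrix contains real eigenvalues only and may be empty, so symmetry has to
  enter. Over the complex numbers an eigenvalue exists. It equals its own conjugate: move the matrix
  across the Hermitian product of its eigenvector with itself. Being a real root of a real
  characteristic polynomial, it is an eigenvalue of the real matrix.
\<close>
lemma symmetric_real_spectrum_non_empty:
  fixes B :: "real mat"
  assumes B: "B \<in> carrier_mat m m" and sym: "B\<^sup>T = B" and m: "m > 0"
  shows "spectrum B \<noteq> {}"
proof -
  define H where "H = map_mat complex_of_real B"
  have H: "H \<in> carrier_mat m m" using B by (simp add: H_def)
  have Hsym: "H\<^sup>T = H" unfolding H_def by (metis map_mat_transpose sym)
  from spectrum_non_empty[OF H m] obtain \<mu> where "\<mu> \<in> spectrum H" by auto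
  hence ev: "eigenvalue H \<mu>" by (simp add: spectrum_def)
  then obtain v where v: "v \<in> carrier_vec m" "v \<noteq> 0\<^sub>v m" and Hv: "H *\<^sub>v v = \<mu> \<cdot>\<^sub>v v"
    using H unfolding eigenvalue_def eigenvector_def by auto
  have conj_Hv: "conjugate (H *\<^sub>v v) = H *\<^sub>v conjugate v"
    by (rule eq_vecI) (use B v in \<open>auto simp: H_def scalar_prod_def\<close>)
  have "\<mu> * (v \<bullet>c v) = (H *\<^sub>v v) \<bullet>c v" using v by (simp add: Hv)
  also have "\<dots> = v \<bullet> (H *\<^sub>v conjugate v)"
    using transpose_vec_mult_scalar[OF H, of "conjugate v" v] v Hsym by simp
  also have "\<dots> = v \<bullet>c (\<mu> \<cdot>\<^sub>v v)" by (simp add: conj_Hv[symmetric] Hv)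
  also have "\<dots> = cnj \<mu> * (v \<bullet>c v)" using v by (simp add: conjugate_smult_vec)
  finally have "\<mu> = cnj \<mu>" using v conjugate_square_eq_0_vec[OF v(1)] by simp
  then obtain r where r: "\<mu> = complex_of_real r"
    by (metis Reals_cnj_iff Reals_cases)
  have "char_poly H = map_poly complex_of_real (char_poly B)"
    unfolding H_def by (rule of_real_hom.char_poly_hom[OF B])
  hence "poly (map_poly complex_of_real (char_poly B)) (complex_of_real r) = 0"
    using ev[unfolded eigenvalue_root_char_poly[OF H]] by (simp only: r)
  hence "poly (char_poly B) r = 0" by simp
  thus ?thesis using eigenvalue_root_char_poly[OF B] by (auto simp: spectrum_def)
qed

section \<open>Products with a diagonal weight, block by block\<close>

lemma diagonal_form_sum:
  fixes D :: "real mat"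
  assumes D: "D \<in> carrier_mat n n" and diag: "diagonal_mat D"
    and u: "u \<in> carrier_vec n" and w: "w \<in> carrier_vec n"
  shows "u \<bullet> (D *\<^sub>v w) = (\<Sum>r<n. D $$ (r, r) * u $ r * w $ r)"
proof -
  have "(D *\<^sub>v w) $ r = D $$ (r, r) * w $ r" if r: "r < n" for r
  proof -
    have "(D *\<^sub>v w) $ r = (\<Sum>s\<in>{0..<n}. D $$ (r, s) * w $ s)"
      using D w r by (simp add: scalar_prod_def)
    also have "\<dots> = (\<Sum>s\<in>{0..<n}. if s = r then D $$ (r, r) * w $ r else 0)"
      using D diag r by (intro sum.cong) (auto simp: diagonal_mat_def)
    finally show ?thesis using r by simp
  qed
  thus ?thesis using D u w by (simp add: scalar_prod_def lessThan_atLeast0 mult_ac)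
qed

lemma congruence_index:
  fixes B M N :: "real mat"
  assumes B: "B \<in> carrier_mat n n" and M: "M \<in> carrier_mat n p" and N: "N \<in> carrier_mat n q"
    and i: "i < p" and j: "j < q"
  shows "(M\<^sup>T * B * N) $$ (i, j) = col M i \<bullet> (B *\<^sub>v col N j)"
proof -
  have "M\<^sup>T * B * N = M\<^sup>T * (B * N)"
    by (rule assoc_mult_mat) (use B M N in auto)
  moreover have "col (B * N) j = B *\<^sub>v col N j"
    using col_mult2[OF B N j] by simp
  ultimately show ?thesis using B M N i j by simp
qed

lemma congruence_form:
  fixes B M N :: "real mat"
  assumes B: "B \<in> carrier_mat n n" and M: "M \<in> carrier_mat n p" and N: "N \<in> carrier_mat n q"
    and x: "x \<in> carrier_vec p" and y: "y \<in> carrier_vec q"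
  shows "(M *\<^sub>v x) \<bullet> (B *\<^sub>v (N *\<^sub>v y)) = x \<bullet> ((M\<^sup>T * B * N) *\<^sub>v y)"
proof -
  have "(M\<^sup>T * B * N) *\<^sub>v y = M\<^sup>T *\<^sub>v (B *\<^sub>v (N *\<^sub>v y))"
    using B M N y
      assoc_mult_mat_vec[of "M\<^sup>T * B" p n N q y] assoc_mult_mat_vec[of "M\<^sup>T" p n B n "N *\<^sub>v y"]
    by simp
  moreover have "x \<bullet> (M\<^sup>T *\<^sub>v (B *\<^sub>v (N *\<^sub>v y))) = (M *\<^sub>v x) \<bullet> (B *\<^sub>v (N *\<^sub>v y))"
    using transpose_vec_mult_scalar[of "M\<^sup>T" p n "B *\<^sub>v (N *\<^sub>v y)" x] B M N x y by simp
  ultimately show ?thesis by simp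
qed

text \<open>
  A submatrix renumbers its rows and columns by \<open>pick\<close>. This bijection turns sums over local indices
  into sums over index sets; its inverse sends \<open>i\<close> to the number of smaller elements of the set,
  which is how local columns are addressed below.
\<close>
lemma bij_betw_pick:
  assumes "finite S"
  shows "bij_betw (pick S) {..<card S} S"
proof (rule bij_betw_imageI)
  show "inj_on (pick S) {..<card S}"
    by (rule linorder_inj_onI) (auto dest: pick_mono_le)
  have "i \<in> pick S ` {..<card S}" if i: "i \<in> S" for i
  proof
    show "i = pick S (card {a\<in>S. a < i})" using pick_card_in_set[OF i] by simp
    show "card {a\<in>S. a < i} \<in> {..<card S}"
      using assms i by (auto intro!: psubset_card_mono)
  qed
  thus "pick S ` {..<card S} = S" by (auto intro: pick_in_set_le)
qed

lemma submatrix_carrier_subset: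
  assumes "M \<in> carrier_mat n p" "I \<subseteq> {..<n}" "J \<subseteq> {..<p}"
  shows "submatrix M I J \<in> carrier_mat (card I) (card J)"
    and "\<And>a b. a < card I \<Longrightarrow> b < card J \<Longrightarrow> submatrix M I J $$ (a, b) = M $$ (pick I a, pick J b)"
proof -
  have *: "{i. i < dim_row M \<and> i \<in> I} = I" "{j. j < dim_col M \<and> j \<in> J} = J"
    using assms by auto
  show "submatrix M I J \<in> carrier_mat (card I) (card J)"
    by (rule carrier_matI) (simp_all only: dim_submatrix *)
  show "\<And>a b. a < card I \<Longrightarrow> b < card J \<Longrightarrow> submatrix M I J $$ (a, b) = M $$ (pick I a, pick J b)"
    by (rule submatrix_index) (simp_all only: *)
qed

lemma diagonal_submatrix:
  fixes D :: "real mat"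
  assumes D: "D \<in> carrier_mat n n" and diag: "diagonal_mat D" and I: "I \<subseteq> {..<n}"
  shows "diagonal_mat (submatrix D I I)"
  unfolding diagonal_mat_def
proof (intro allI impI)
  fix a b
  assume "a < dim_row (submatrix D I I)" "b < dim_col (submatrix D I I)" and ab: "a \<noteq> b"
  hence a: "a < card I" and b: "b < card I"
    using submatrix_carrier_subset(1)[OF D I I] by auto
  have bij: "bij_betw (pick I) {..<card I} I"
    using I by (intro bij_betw_pick) (rule finite_subset, auto)
  have "pick I a \<noteq> pick I b" using bij a b ab by (auto simp: bij_betw_def inj_on_def)
  moreover have "pick I a < n" "pick I b < n" using bij_betwE[OF bij] a b I by auto
  ultimately show "submatrix D I I $$ (a, b) = 0"
    using submatrix_carrier_subset(2)[OF D I I a b] D diag by (auto simp: diagonal_mat_def)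
qed

lemma submatrix_diagonal_form_sum:
  fixes D M N :: "real mat"
  assumes D: "D \<in> carrier_mat n n" and diag: "diagonal_mat D"
    and M: "M \<in> carrier_mat n p" and N: "N \<in> carrier_mat n q"
    and I: "I \<subseteq> {..<n}" and J: "J \<subseteq> {..<p}" and K: "K \<subseteq> {..<q}"
    and a: "a < card J" and b: "b < card K"
  shows "col (submatrix M I J) a \<bullet> (submatrix D I I *\<^sub>v col (submatrix N I K) b) =
    (\<Sum>r\<in>I. D $$ (r, r) * M $$ (r, pick J a) * N $$ (r, pick K b))"
proof -
  note MJ = submatrix_carrier_subset[OF M I J] and NK = submatrix_carrier_subset[OF N I K]
    and DI = submatrix_carrier_subset[OF D I I]
  have bij: "bij_betw (pick I) {..<card I} I"
    using I by (intro bij_betw_pick) (rule finite_subset, auto)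
  have "col (submatrix M I J) a \<bullet> (submatrix D I I *\<^sub>v col (submatrix N I K) b) =
    (\<Sum>r<card I. submatrix D I I $$ (r, r) * col (submatrix M I J) a $ r * col (submatrix N I K) b $ r)"
    by (rule diagonal_form_sum[OF DI(1) diagonal_submatrix[OF D diag I]])
      (use MJ(1) NK(1) a b in \<open>auto simp: carrier_vecI\<close>)
  also have "\<dots> = (\<Sum>r<card I. D $$ (pick I r, pick I r) * M $$ (pick I r, pick J a) * N $$ (pick I r, pick K b))"
    using MJ NK DI(2) a b by (intro sum.cong refl) (auto simp: index_col)
  also have "\<dots> = (\<Sum>r\<in>I. D $$ (r, r) * M $$ (r, pick J a) * N $$ (r, pick K b))"
    by (rule sum.reindex_bij_betw[OF bij])
  finally show ?thesis .
qed

lemma block_diagonal_zero: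
  assumes M: "block_diagonal k R C M" and s: "s < k" and i: "i \<in> C s"
    and r: "r < dim_row M" "r \<notin> R s"
  shows "M $$ (r, i) = 0"
proof -
  have "r \<in> (\<Union>t<k. R t)" using M r(1) by (simp add: block_diagonal_def indexed_partition_def)
  then obtain t where t: "t < k" "r \<in> R t" by auto
  hence "t \<noteq> s" using r(2) by auto
  moreover have "\<forall>u<k. \<forall>t<k. u \<noteq> t \<longrightarrow> (\<forall>r\<in>R u. \<forall>c\<in>C t. M $$ (r, c) = 0)"
    using M by (simp add: block_diagonal_def)
  ultimately show ?thesis using s i t by blast
qed

lemma block_diagonal_index_sets:
  assumes "block_diagonal k R C M" "s < k"
  shows "R s \<subseteq> {..<dim_row M}" and "C s \<subseteq> {..<dim_col M}"
proof -
  have "(\<Union>s<k. R s) = {..<dim_row M}" "(\<Union>s<k. C s) = {..<dim_col M}"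
    using assms(1) by (auto simp only: block_diagonal_def indexed_partition_def)
  thus "R s \<subseteq> {..<dim_row M}" "C s \<subseteq> {..<dim_col M}" using assms(2) by auto
qed

text \<open>
  Conditions imposed aggregate by aggregate become global through this identity: a column vanishes
  outside its own aggregate, and a diagonal weight does not couple rows. Columns of different
  aggregates therefore have disjoint supports, and within one aggregate nothing is lost by
  restricting to it.
\<close>
lemma block_diagonal_weighted_product:
  fixes D M N :: "real mat"
  assumes D: "D \<in> carrier_mat n n" and diag: "diagonal_mat D"
    and M: "M \<in> carrier_mat n p" and N: "N \<in> carrier_mat n q"
    and bM: "block_diagonal k R C M" and bN: "block_diagonal k R F N"
    and s: "s < k" and i: "i \<in> C s" and t: "t < k" and j: "j \<in> F t"
  shows "col M i \<bullet> (D *\<^sub>v col N j) =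
    (if s = t then col (submatrix M (R s) (C s)) (card {a\<in>C s. a < i}) \<bullet>
       (submatrix D (R s) (R s) *\<^sub>v col (submatrix N (R s) (F s)) (card {a\<in>F s. a < j}))
     else 0)"
proof -
  have R: "R s \<subseteq> {..<n}" and C: "C s \<subseteq> {..<p}" and F: "F t \<subseteq> {..<q}"
    using block_diagonal_index_sets[OF bM s] block_diagonal_index_sets[OF bN t] M N by simp_all
  have i': "i < p" and j': "j < q" using C F i j by auto
  have zM: "M $$ (r, i) = 0" if "r < n" "r \<notin> R s" for r
    using block_diagonal_zero[OF bM s i] M that by auto
  have zN: "N $$ (r, j) = 0" if "r < n" "r \<notin> R t" for r
    using block_diagonal_zero[OF bN t j] N that by auto
  have sum: "col M i \<bullet> (D *\<^sub>v col N j) = (\<Sum>r<n. D $$ (r, r) * M $$ (r, i) * N $$ (r, j))"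
    using diagonal_form_sum[OF D diag, of "col M i" "col N j"] M N i' j' by auto
  show ?thesis
  proof (cases "s = t")
    case True
    have "(\<Sum>r<n. D $$ (r, r) * M $$ (r, i) * N $$ (r, j)) =
      (\<Sum>r\<in>R s. D $$ (r, r) * M $$ (r, i) * N $$ (r, j))"
      by (rule sum.mono_neutral_right) (use R zM in auto)
    moreover have "card {a\<in>C s. a < i} < card (C s)"
      using i finite_subset[OF C] by (auto intro!: psubset_card_mono)
    moreover have "card {a\<in>F s. a < j} < card (F s)"
      using j finite_subset[OF F] True by (auto intro!: psubset_card_mono)
    ultimately show ?thesis
      using submatrix_diagonal_form_sum[OF D diag M N R C, of "F s"] True F sum i j
      by (simp add: pick_card_in_set)
  next
    case False
    have "disjoint_family_on R {..<k}"
      using bM by (simp add: block_diagonal_def indexed_partition_def)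
    hence "R s \<inter> R t = {}" using False s t by (auto simp: disjoint_family_on_def)
    hence "D $$ (r, r) * M $$ (r, i) * N $$ (r, j) = 0" if "r < n" for r
      using zM[OF that] zN[OF that] by auto
    hence "(\<Sum>r<n. D $$ (r, r) * M $$ (r, i) * N $$ (r, j)) = 0" by (intro sum.neutral) simp
    thus ?thesis using False sum by simp
  qed
qed

lemma col_in_mat_range:
  assumes "j < dim_col M"
  shows "col M j \<in> mat_range M"
proof -
  interpret vec_space "TYPE(real)" "dim_row M" .
  have "col M j \<in> set (cols M)" using assms by (auto simp: cols_def)
  moreover have "set (cols M) \<subseteq> carrier_vec (dim_row M)" using cols_dim by blast
  ultimately show ?thesis unfolding mat_range_def col_space_def using in_own_span by blast
qed

lemma block_diagonal_columnE:
  assumes "block_diagonal k R C M" "j < dim_col M"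
  obtains s where "s < k" "j \<in> C s"
proof -
  have "j \<in> (\<Union>s<k. C s)"
    using assms by (simp add: block_diagonal_def indexed_partition_def)
  thus ?thesis using that by auto
qed

lemma block_diagonal_local_column:
  assumes bM: "block_diagonal k R C M" and s: "s < k" and i: "i \<in> C s"
  shows "card {a\<in>C s. a < i} < dim_col (submatrix M (R s) (C s))"
proof -
  have C: "C s \<subseteq> {..<dim_col M}" and R: "R s \<subseteq> {..<dim_row M}"
    by (rule block_diagonal_index_sets[OF bM s])+
  have "card {a\<in>C s. a < i} < card (C s)"
    using i finite_subset[OF C] by (auto intro!: psubset_card_mono)
  thus ?thesis using submatrix_carrier_subset(1)[of M "dim_row M" "dim_col M" "R s" "C s"] R C by auto
qed

lemma aggregate_complement_orthonormal:
  assumes D: "D \<in> carrier_mat n n" and diag: "diagonal_mat D" and Q: "Q \<in> carrier_mat n q"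
    and compl: "aggregate_complement k Agg C F D P Q"
  shows "Q\<^sup>T * D * Q = 1\<^sub>m q"
proof (rule eq_matI)
  have bQ: "block_diagonal k Agg F Q" using compl by (simp add: aggregate_complement_def)
  fix i j assume "i < dim_row (1\<^sub>m q :: real mat)" "j < dim_col (1\<^sub>m q :: real mat)"
  hence i: "i < q" and j: "j < q" by auto
  obtain s where s: "s < k" "i \<in> F s" using block_diagonal_columnE[OF bQ] i Q by auto
  obtain t where t: "t < k" "j \<in> F t" using block_diagonal_columnE[OF bQ] j Q by auto
  let ?a = "card {a\<in>F s. a < i}" and ?b = "card {a\<in>F s. a < j}"
  have "col Q i \<bullet> (D *\<^sub>v col Q j) = (if i = j then 1 else 0)"
  proof (cases "s = t")
    case True
    have "orthonormal_cols_wrt (submatrix D (Agg s) (Agg s)) (submatrix Q (Agg s) (F s))"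
      using compl s by (simp add: aggregate_complement_def)
    hence "col (submatrix Q (Agg s) (F s)) ?a \<bullet>
       (submatrix D (Agg s) (Agg s) *\<^sub>v col (submatrix Q (Agg s) (F s)) ?b) = (if ?a = ?b then 1 else 0)"
      unfolding orthonormal_cols_wrt_def
      using block_diagonal_local_column[OF bQ s] block_diagonal_local_column[OF bQ t] True by auto
    moreover have "?a = ?b \<longleftrightarrow> i = j"
      using pick_card_in_set[OF s(2)] pick_card_in_set[OF t(2)] True by metis
    ultimately show ?thesis
      using block_diagonal_weighted_product[OF D diag Q Q bQ bQ s t] True by simp
  next
    case False
    have "disjoint_family_on F {..<k}"
      using bQ by (simp add: block_diagonal_def indexed_partition_def)
    hence "i \<noteq> j" using False s t by (auto simp: disjoint_family_on_def)
    thus ?thesis using block_diagonal_weighted_product[OF D diag Q Q bQ bQ s t] False by simp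
  qed
  thus "(Q\<^sup>T * D * Q) $$ (i, j) = (1\<^sub>m q) $$ (i, j)"
    using congruence_index[OF D Q Q i j] i j by simp
qed (use Q in auto)

text \<open>
  A local column of \<open>Q\<close> lies in the range of its block, hence in the orthogonal complement of the
  range of the corresponding block of \<open>P\<close>, to which the local columns of \<open>P\<close> belong.
\<close>
lemma aggregate_complement_orthogonal:
  assumes D: "D \<in> carrier_mat n n" and diag: "diagonal_mat D"
    and P: "P \<in> carrier_mat n p" and Q: "Q \<in> carrier_mat n q"
    and bP: "block_diagonal k Agg C P"
    and compl: "aggregate_complement k Agg C F D P Q"
  shows "Q\<^sup>T * D * P = 0\<^sub>m q p"
proof (rule eq_matI)
  have bQ: "block_diagonal k Agg F Q" using compl by (simp add: aggregate_complement_def)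
  fix i j assume "i < dim_row (0\<^sub>m q p :: real mat)" "j < dim_col (0\<^sub>m q p :: real mat)"
  hence i: "i < q" and j: "j < p" by auto
  obtain s where s: "s < k" "i \<in> F s" using block_diagonal_columnE[OF bQ] i Q by auto
  obtain t where t: "t < k" "j \<in> C t" using block_diagonal_columnE[OF bP] j P by auto
  let ?a = "card {a\<in>F s. a < i}" and ?b = "card {a\<in>C s. a < j}"
  have "col Q i \<bullet> (D *\<^sub>v col P j) = 0"
  proof (cases "s = t")
    case True
    have "col (submatrix Q (Agg s) (F s)) ?a \<in> orthogonal_complement_wrt
        (submatrix D (Agg s) (Agg s)) (mat_range (submatrix P (Agg s) (C s)))"
      using compl s col_in_mat_range[OF block_diagonal_local_column[OF bQ s]]
      by (simp add: aggregate_complement_def)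
    moreover have "col (submatrix P (Agg s) (C s)) ?b \<in> mat_range (submatrix P (Agg s) (C s))"
      using col_in_mat_range[OF block_diagonal_local_column[OF bP t]] True by simp
    ultimately have "col (submatrix Q (Agg s) (F s)) ?a \<bullet>
       (submatrix D (Agg s) (Agg s) *\<^sub>v col (submatrix P (Agg s) (C s)) ?b) = 0"
      unfolding orthogonal_complement_wrt_def by blast
    thus ?thesis using block_diagonal_weighted_product[OF D diag Q P bQ bP s t] True by simp
  next
    case False
    thus ?thesis using block_diagonal_weighted_product[OF D diag Q P bQ bP s t] by simp
  qed
  thus "(Q\<^sup>T * D * P) $$ (i, j) = (0\<^sub>m q p) $$ (i, j)"
    using congruence_index[OF D Q P i j] i j by simp
qed (use P Q in auto)

section \<open>The bound on the condition number\<close>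

lemma spd_mat_form_nonneg:
  assumes "spd_mat n B" "v \<in> carrier_vec n"
  shows "v \<bullet> (B *\<^sub>v v) \<ge> 0"
proof (cases "v = 0\<^sub>v n")
  case True
  have "B *\<^sub>v v \<in> carrier_vec n" using assms by (auto simp: spd_mat_def)
  thus ?thesis using True by simp
next
  case False
  thus ?thesis using assms by (auto simp: spd_mat_def less_imp_le)
qed

text \<open>
  Pythagoras: the cross terms vanish and \<open>w\<close> contributes only its own, nonnegative, energy.
\<close>
lemma orthogonal_correction_form_ge:
  assumes B: "spd_mat n B" and u: "u \<in> carrier_vec n" and w: "w \<in> carrier_vec n"
    and orth: "u \<bullet> (B *\<^sub>v w) = 0"
  shows "u \<bullet> (B *\<^sub>v u) \<le> (u - w) \<bullet> (B *\<^sub>v (u - w))"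
proof -
  have Bc: "B \<in> carrier_mat n n" and sym: "B\<^sup>T = B" using B by (auto simp: spd_mat_def)
  have Bu: "B *\<^sub>v u \<in> carrier_vec n" and Bw: "B *\<^sub>v w \<in> carrier_vec n"
    using Bc u w by auto
  have "w \<bullet> (B *\<^sub>v u) = (B *\<^sub>v w) \<bullet> u"
    using transpose_vec_mult_scalar[OF Bc u w] sym by simp
  also have "\<dots> = 0" using comm_scalar_prod[OF Bw u] orth by simp
  finally have wu: "w \<bullet> (B *\<^sub>v u) = 0" .
  have "(u - w) \<bullet> (B *\<^sub>v (u - w)) = u \<bullet> (B *\<^sub>v u) + w \<bullet> (B *\<^sub>v w)"
    using u w Bu Bw orth wu
    by (simp add: mult_minus_distrib_mat_vec[OF Bc u w] minus_scalar_prod_distrib[of _ n]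
        scalar_prod_minus_distrib[of _ n])
  thus ?thesis using spd_mat_form_nonneg[OF B w] by simp
qed

lemma spectral_condition_number_le:
  assumes B: "B \<in> carrier_mat m m" and ne: "spectrum B \<noteq> {}"
    and lo: "\<And>\<mu>. \<mu> \<in> spectrum B \<Longrightarrow> a \<le> \<mu>" and hi: "\<And>\<mu>. \<mu> \<in> spectrum B \<Longrightarrow> \<mu> \<le> b"
    and a: "a > 0"
  shows "spectral_condition_number B \<le> b / a"
proof -
  have fin: "finite (spectrum B)" by (rule card_finite_spectrum[OF B])
  have Mx: "Max (spectrum B) \<in> spectrum B" and Mn: "Min (spectrum B) \<in> spectrum B"
    using fin ne by auto
  have "0 \<le> b" using a lo[OF Mx] hi[OF Mx] by linarith
  thus ?thesis unfolding spectral_condition_number_def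
    using lo[OF Mn] hi[OF Mx] a by (intro frac_le) auto
qed

theorem theorem2p2:
  fixes A D P P\<^sub>f :: "real mat"
    and n n\<^sub>c n\<^sub>a :: nat
    and Agg C F :: "nat \<Rightarrow> nat set"
    and \<eta>\<^sub>w :: real
  assumes A_spd: "spd_mat n A"
    and D_spd: "spd_mat n D"
    and D_diag: "diagonal_mat D"
    and A_le_D: "\<forall>v \<in> carrier_vec n. v \<bullet> (A *\<^sub>v v) \<le> v \<bullet> (D *\<^sub>v v)"
    and aggregates: "indexed_partition {..<n} n\<^sub>a Agg" "\<forall>i<n\<^sub>a. Agg i \<noteq> {}"
    and n\<^sub>c: "1 \<le> n\<^sub>c" "n\<^sub>c < n"
    and P_dim: "P \<in> carrier_mat n n\<^sub>c"
    and P_rank: "vec_space.rank n P = n\<^sub>c"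
    and P_block: "block_diagonal n\<^sub>a Agg C P"
    and Pf_dim: "P\<^sub>f \<in> carrier_mat n (n - n\<^sub>c)"
    and Pf_compl: "aggregate_complement n\<^sub>a Agg C F D P P\<^sub>f"
    and eta_pos: "\<eta>\<^sub>w > 0"
    and wap: "weak_approximation_property A D P \<eta>\<^sub>w"
  shows "spectral_condition_number (P\<^sub>f\<^sup>T * A * P\<^sub>f) \<le> \<eta>\<^sub>w\<^sup>2"
proof -
  let ?Q = "P\<^sub>f" and ?m = "n - n\<^sub>c"
  let ?Af = "?Q\<^sup>T * A * ?Q"
  have A: "A \<in> carrier_mat n n" and A_sym: "A\<^sup>T = A" using A_spd by (auto simp: spd_mat_def)
  have D: "D \<in> carrier_mat n n" using D_spd by (auto simp: spd_mat_def)
  note Q = Pf_dim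
  have Af: "?Af \<in> carrier_mat ?m ?m" using A Q by auto
  \<comment> \<open>Symmetry is what makes the extreme eigenvalues in the condition number exist.\<close>
  have "?Af\<^sup>T = ?Q\<^sup>T * (?Q\<^sup>T * A)\<^sup>T"
    using A Q by (intro transpose_mult[of _ ?m n _ ?m]) auto
  also have "(?Q\<^sup>T * A)\<^sup>T = A * ?Q"
    using A Q A_sym transpose_mult[of "?Q\<^sup>T" ?m n A n] by simp
  also have "?Q\<^sup>T * (A * ?Q) = ?Af"
    using A Q by (intro assoc_mult_mat[symmetric, of _ ?m n _ n _ ?m]) auto
  finally have Af_sym: "?Af\<^sup>T = ?Af" .
  have nonempty: "spectrum ?Af \<noteq> {}"
    using symmetric_real_spectrum_non_empty[OF Af Af_sym] n\<^sub>c by simp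
  have bounds: "1 / \<eta>\<^sub>w\<^sup>2 \<le> \<mu> \<and> \<mu> \<le> 1" if spec: "\<mu> \<in> spectrum ?Af" for \<mu>
  proof -
    obtain x where x: "x \<in> carrier_vec ?m" and x0: "x \<noteq> 0\<^sub>v ?m" and ev: "?Af *\<^sub>v x = \<mu> \<cdot>\<^sub>v x"
      using spec Af unfolding spectrum_def eigenvalue_def eigenvector_def by auto
    define v where "v = ?Q *\<^sub>v x"
    have v: "v \<in> carrier_vec n" using Q x by (simp add: v_def)
    have xx: "x \<bullet> x > 0"
      using conjugate_square_greater_0_vec[OF x] x0 by simp
    have vA: "v \<bullet> (A *\<^sub>v v) = \<mu> * (x \<bullet> x)"
      unfolding v_def using congruence_form[OF A Q Q x x] ev x by simp
    have vD: "v \<bullet> (D *\<^sub>v v) = x \<bullet> x"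
      unfolding v_def using congruence_form[OF D Q Q x x] x
        aggregate_complement_orthonormal[OF D D_diag Q Pf_compl] by simp
    obtain vc where vc: "vc \<in> carrier_vec n\<^sub>c"
      and approx: "energy_norm D (v - P *\<^sub>v vc) \<le> \<eta>\<^sub>w * energy_norm A v"
      using wap v P_dim unfolding weak_approximation_property_def by auto
    have Pvc: "P *\<^sub>v vc \<in> carrier_vec n" using P_dim vc by simp
    have "0\<^sub>m ?m n\<^sub>c *\<^sub>v vc = 0\<^sub>v ?m" using vc by (intro eq_vecI) auto
    hence "v \<bullet> (D *\<^sub>v (P *\<^sub>v vc)) = 0"
      unfolding v_def using congruence_form[OF D Q P_dim x vc] x vc
        aggregate_complement_orthogonal[OF D D_diag P_dim Q P_block Pf_compl] by simp
    from orthogonal_correction_form_ge[OF D_spd v Pvc this]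
    have "x \<bullet> x \<le> (energy_norm D (v - P *\<^sub>v vc))\<^sup>2"
      using spd_mat_form_nonneg[OF D_spd, of "v - P *\<^sub>v vc"] v Pvc vD by (simp add: energy_norm_def)
    also have "\<dots> \<le> (\<eta>\<^sub>w * energy_norm A v)\<^sup>2"
      using spd_mat_form_nonneg[OF D_spd, of "v - P *\<^sub>v vc"] v Pvc
      by (intro power_mono approx) (simp add: energy_norm_def)
    also have "\<dots> = \<eta>\<^sub>w\<^sup>2 * \<mu> * (x \<bullet> x)"
      using spd_mat_form_nonneg[OF A_spd v] vA by (simp add: energy_norm_def power_mult_distrib)
    finally have "1 \<le> \<eta>\<^sub>w\<^sup>2 * \<mu>" using xx by simp
    hence "1 / \<eta>\<^sub>w\<^sup>2 \<le> \<mu>" using eta_pos by (simp add: divide_simps mult.commute)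
    moreover have "\<mu> * (x \<bullet> x) \<le> 1 * (x \<bullet> x)" using A_le_D v vA vD by fastforce
    hence "\<mu> \<le> 1" using xx by simp
    ultimately show ?thesis by simp
  qed
  have "spectral_condition_number ?Af \<le> 1 / (1 / \<eta>\<^sub>w\<^sup>2)"
    by (rule spectral_condition_number_le[OF Af nonempty]) (use bounds eta_pos in auto)
  thus ?thesis by simp
qed

end
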